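(* Let $L,n\in\mathbb{N}$, let $(\mathcal{C}(z))_{z\in\mathcal{T}_L}$ be a cell representation of $\mathcal{T}_L$, and let $(\delta_z)_{z\in\mathcal{T}_L}$ be a scaffolding. Consider the following two algorithms. Algorithm 2. Input: a Motzkin path $m=(m[1],\dots,m[n])$ with amplitude bounded by $L$. Set $p$ to be the empty path, $z:=\mathcal{O}$, and $c$ the unique cell of height $0$ in $\mathcal{C}(z)$. For $i$ from $1$ to $n$: set $(\sigma,c):=\delta_z(c,m[i])$; add $\sigma$ to the end of $p$; set $z:=z+\sigma$. Return $p$. Algorithm 3. Input: a forward path $p=(p[1],\dots,p[n])$ in $\mathcal{T}_L$ starting at $\mathcal{O}$. Set $m$ to be the empty path, $z:=\mathcal{O}+\sum_{i=1}^n p[i]$, and $c$ the unique cell of height $0$ in $\mathcal{C}(z)$. For $i$ decreasing from $n$ to $1$: set $z:=z-p[i]$; set $(c,s):=\delta_{z}^{-1}(p[i],c)$; add $s$ to the beginning of $m$. Return $m$. Then these two algorithms give two mutually inverse bijections between the set of Motzkin paths of length $n$ with amplitude bounded by $L$ and the set of forward paths of $\mathcal{T}_L$ of length $n$ starting at $\mathcal{O}$.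
   Context: $\mathbb{N}=\{0,1,2,\dots\}$, $(e_1,e_2,e_3)$ is the standard basis of $\mathbb{R}^3$, $\mathcal{T}_L=\{x_1e_1+x_2e_2+x_3e_3 : x_1,x_2,x_3\in\mathbb{N},\ x_1+x_2+x_3=L\}$, $\mathcal{O}=Le_3$, $s_1=e_1-e_3$, $s_2=e_2-e_1$, $s_3=e_3-e_2$, and $H=\lfloor L/2\rfloor$. A forward path of length $n$ starting from $z$ is a sequence $(\sigma_1,\dots,\sigma_n)\in\{s_1,s_2,s_3\}^n$ with $z+\sum_{i=1}^k\sigma_i\in\mathcal{T}_L$ for all $k\in\{0,\dots,n\}$. A Motzkin path is a sequence of steps $\nearrow$ (height $+1$), $\rightarrow$ (height $+0$), $\searrow$ (height $-1$) starting at height $0$, staying at height $\ge0$ and ending at height $0$. Its amplitude, if its maximum height is $h$, is $2h+1$ if a horizontal step is performed at height $h$ and $2h$ otherwise; "bounded by $L$" means $\le L$. Profile: for $z=ae_1+be_2+ce_3\in\mathcal{T}_L$, $p_0(z),\dots,p_H(z)$ are the coefficients of $x^0,\dots,x^H$ in $\frac{(1-x^{a+1})(1-x^{b+1})(1-x^{c+1})}{(1-x)^2}$ (in particular $p_0(z)=1$). Cell representation of $\mathcal{T}_L$: a family $(\mathcal{C}(z))_{z\in\mathcal{T}_L}$ where each $\mathcal{C}(z)$ is a finite subset of $\{0,\dots,H\}\times\mathbb{Z}$ such that $|\{\ell : (f,\ell)\in\mathcal{C}(z)\}|=p_f(z)$ for every $f\in\{0,\dots,H\}$. The height of a cell $c=(f,\ell)$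 is $h(c)=f$. By convention $\mathcal{C}(z)=\emptyset$ if $z\notin\mathcal{T}_L$. Allowed steps: for $f\in\{0,\dots,H\}$, a step $s\in\{\nearrow,\rightarrow,\searrow\}$ is allowed from height $f$ unless $(f,s)=(0,\searrow)$, or $(f,s)=(H,\nearrow)$, or $L$ is even and $(f,s)=(H,\rightarrow)$. Let $A(z)=\{(c,s)\in\mathcal{C}(z)\times\{\nearrow,\rightarrow,\searrow\} : s\text{ is allowed from height }h(c)\}$ and $\mathcal{C}_i(z)=\{(s_i,c): c\in\mathcal{C}(z)\}$ for $i\in\{1,2,3\}$. A scaffolding is a collection of functions $(\delta_z)_{z\in\mathcal{T}_L}$ such that for each $z\in\mathcal{T}_L$, $\delta_z:A(z)\to\mathcal{C}_1(z+s_1)\cup\mathcal{C}_2(z+s_2)\cup\mathcal{C}_3(z+s_3)$ is a bijection and, for every $(c,s)\in A(z)$ with $\delta_z(c,s)=(\sigma,c')$, one has $h(c')=h(c)+1$ if $s=\nearrow$, $h(c')=h(c)$ if $s=\rightarrow$, and $h(c')=h(c)-1$ if $s=\searrow$. *)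

theory Defs
  imports "HOL-Analysis.Analysis" "HOL-Computational_Algebra.Formal_Power_Series"
begin

section \<open>The triangular lattice and forward paths\<close>

type_synonym point = "real ^ 3"

text \<open>The indices \<open>1, 2, 3\<close> below are the three elements of the index type \<open>3\<close>
  (in which \<open>3 = 0\<close>).\<close>

definition e\<^sub>1 :: point where "e\<^sub>1 = axis 1 1"
definition e\<^sub>2 :: point where "e\<^sub>2 = axis 2 1"
definition e\<^sub>3 :: point where "e\<^sub>3 = axis 3 1"

definition pt :: "nat \<Rightarrow> nat \<Rightarrow> nat \<Rightarrow> point" where
  "pt a b c = real a *\<^sub>R e\<^sub>1 + real b *\<^sub>R e\<^sub>2 + real c *\<^sub>R e\<^sub>3"

definition triangle :: "nat \<Rightarrow> point set" where
  "triangle L = {pt a b c | a b c. a + b + c = L}"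

definition origin :: "nat \<Rightarrow> point" where
  "origin L = real L *\<^sub>R e\<^sub>3"

definition s\<^sub>1 :: point where "s\<^sub>1 = e\<^sub>1 - e\<^sub>3"
definition s\<^sub>2 :: point where "s\<^sub>2 = e\<^sub>2 - e\<^sub>1"
definition s\<^sub>3 :: point where "s\<^sub>3 = e\<^sub>3 - e\<^sub>2"

definition forward_path :: "nat \<Rightarrow> point \<Rightarrow> point list \<Rightarrow> bool" where
  "forward_path L z p \<longleftrightarrow>
     set p \<subseteq> {s\<^sub>1, s\<^sub>2, s\<^sub>3} \<and>
     (\<forall>k \<le> length p. z + sum_list (take k p) \<in> triangle L)"

definition forward_paths :: "nat \<Rightarrow> nat \<Rightarrow> point list set" where
  "forward_paths L n = {p. length p = n \<and> forward_path L (origin L) p}"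


section \<open>Motzkin paths\<close>

datatype mstep = Up | Flat | Down

primrec rise :: "mstep \<Rightarrow> int" where
  "rise Up = 1"
| "rise Flat = 0"
| "rise Down = -1"

definition height_after :: "mstep list \<Rightarrow> nat \<Rightarrow> int" where
  "height_after m k = sum_list (map rise (take k m))"

definition motzkin_path :: "mstep list \<Rightarrow> bool" where
  "motzkin_path m \<longleftrightarrow>
     (\<forall>k \<le> length m. height_after m k \<ge> 0) \<and> height_after m (length m) = 0"

definition max_height :: "mstep list \<Rightarrow> int" where
  "max_height m = Max (height_after m ` {0..length m})"

definition amplitude :: "mstep list \<Rightarrow> int" where
  "amplitude m =
     (if \<exists>i < length m. m ! i = Flat \<and> height_after m i = max_height m
      then 2 * max_height m + 1 else 2 * max_height m)"

definition bounded_motzkin_paths :: "nat \<Rightarrow> nat \<Rightarrow> mstep list set" where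
  "bounded_motzkin_paths L n =
     {m. length m = n \<and> motzkin_path m \<and> amplitude m \<le> int L}"


section \<open>Cell representations\<close>

definition profile :: "nat \<Rightarrow> nat \<Rightarrow> nat \<Rightarrow> nat \<Rightarrow> real" where
  "profile a b c f =
     fps_nth ((1 - fps_X ^ (a + 1)) * (1 - fps_X ^ (b + 1)) * (1 - fps_X ^ (c + 1))
              / (1 - fps_X)\<^sup>2) f"

type_synonym cell = "nat \<times> int"

abbreviation cell_height :: "cell \<Rightarrow> nat" where
  "cell_height \<equiv> fst"

text \<open>Families indexed by the triangle are total functions on \<open>point\<close>. For cells, the
  convention that points outside the triangle carry no cell is imposed by the last conjunct.\<close>

definition cell_representation :: "nat \<Rightarrow> (point \<Rightarrow> cell set) \<Rightarrow> bool" where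
  "cell_representation L C \<longleftrightarrow>
     (\<forall>z \<in> triangle L. finite (C z) \<and> C z \<subseteq> {0..L div 2} \<times> UNIV) \<and>
     (\<forall>a b c f. a + b + c = L \<longrightarrow> f \<le> L div 2 \<longrightarrow>
        real (card {l. (f, l) \<in> C (pt a b c)}) = profile a b c f) \<and>
     (\<forall>z. z \<notin> triangle L \<longrightarrow> C z = {})"

definition ground_cell :: "(point \<Rightarrow> cell set) \<Rightarrow> point \<Rightarrow> cell" where
  "ground_cell C z = (THE c. c \<in> C z \<and> cell_height c = 0)"


section \<open>Scaffoldings\<close>

definition step_allowed :: "nat \<Rightarrow> nat \<Rightarrow> mstep \<Rightarrow> bool" where
  "step_allowed L f s \<longleftrightarrow>
     \<not> (f = 0 \<and> s = Down) \<and>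
     \<not> (f = L div 2 \<and> s = Up) \<and>
     \<not> (even L \<and> f = L div 2 \<and> s = Flat)"

definition allowed :: "nat \<Rightarrow> (point \<Rightarrow> cell set) \<Rightarrow> point \<Rightarrow> (cell \<times> mstep) set" where
  "allowed L C z = {(c, s). c \<in> C z \<and> step_allowed L (cell_height c) s}"

definition successors :: "(point \<Rightarrow> cell set) \<Rightarrow> point \<Rightarrow> (point \<times> cell) set" where
  "successors C z =
     {s\<^sub>1} \<times> C (z + s\<^sub>1) \<union> {s\<^sub>2} \<times> C (z + s\<^sub>2) \<union> {s\<^sub>3} \<times> C (z + s\<^sub>3)"

definition scaffolding ::
  "nat \<Rightarrow> (point \<Rightarrow> cell set) \<Rightarrow> (point \<Rightarrow> cell \<times> mstep \<Rightarrow> point \<times> cell) \<Rightarrow> bool" where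
  "scaffolding L C \<delta> \<longleftrightarrow>
     (\<forall>z \<in> triangle L.
        bij_betw (\<delta> z) (allowed L C z) (successors C z) \<and>
        (\<forall>c s \<sigma> c'. (c, s) \<in> allowed L C z \<longrightarrow> \<delta> z (c, s) = (\<sigma>, c') \<longrightarrow>
           int (cell_height c') = int (cell_height c) + rise s))"


section \<open>The two algorithms\<close>

text \<open>The result \<open>None\<close> means that \<open>\<delta>\<^sub>z\<close> or its inverse would be applied outside its
  domain, so that the algorithm is not well defined on the given input. The loop state
  consists of the output built so far, the current point and the current cell.\<close>

fun motzkin_to_forward_loop ::
  "nat \<Rightarrow> (point \<Rightarrow> cell set) \<Rightarrow> (point \<Rightarrow> cell \<times> mstep \<Rightarrow> point \<times> cell) \<Rightarrow>
   point list \<times> point \<times> cell \<Rightarrow> mstep list \<Rightarrow> point list option" where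
  "motzkin_to_forward_loop L C \<delta> (p, z, c) [] = Some p"
| "motzkin_to_forward_loop L C \<delta> (p, z, c) (s # m) =
     (if z \<in> triangle L \<and> (c, s) \<in> allowed L C z
      then let (\<sigma>, c') = \<delta> z (c, s)
           in motzkin_to_forward_loop L C \<delta> (p @ [\<sigma>], z + \<sigma>, c') m
      else None)"

definition motzkin_to_forward ::
  "nat \<Rightarrow> (point \<Rightarrow> cell set) \<Rightarrow> (point \<Rightarrow> cell \<times> mstep \<Rightarrow> point \<times> cell) \<Rightarrow>
   mstep list \<Rightarrow> point list option" where
  "motzkin_to_forward L C \<delta> m =
     motzkin_to_forward_loop L C \<delta> ([], origin L, ground_cell C (origin L)) m"

text \<open>The second loop receives the steps of the forward path in reverse order.\<close>

fun forward_to_motzkin_loop ::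
  "nat \<Rightarrow> (point \<Rightarrow> cell set) \<Rightarrow> (point \<Rightarrow> cell \<times> mstep \<Rightarrow> point \<times> cell) \<Rightarrow>
   mstep list \<times> point \<times> cell \<Rightarrow> point list \<Rightarrow> mstep list option" where
  "forward_to_motzkin_loop L C \<delta> (m, z, c) [] = Some m"
| "forward_to_motzkin_loop L C \<delta> (m, z, c) (\<sigma> # p) =
     (let z' = z - \<sigma>
      in if z' \<in> triangle L \<and> (\<sigma>, c) \<in> successors C z'
         then let (c', s) = the_inv_into (allowed L C z') (\<delta> z') (\<sigma>, c)
              in forward_to_motzkin_loop L C \<delta> (s # m, z', c') p
         else None)"

definition forward_to_motzkin ::
  "nat \<Rightarrow> (point \<Rightarrow> cell set) \<Rightarrow> (point \<Rightarrow> cell \<times> mstep \<Rightarrow> point \<times> cell) \<Rightarrow>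
   point list \<Rightarrow> mstep list option" where
  "forward_to_motzkin L C \<delta> p =
     (let z = origin L + sum_list p
      in forward_to_motzkin_loop L C \<delta> ([], z, ground_cell C z) (rev p))"

end

theory Submission
  imports Defs
begin

text \<open>Both algorithms walk along the same runs: chains of cells linked by
  the bijections \<open>\<delta>\<^sub>z\<close>, the first from front to back and the second from back to front. A Motzkin path
  has amplitude at most \<open>L\<close> exactly when each of its steps is allowed from the height at which
  it is performed, so the first algorithm never gets stuck, and it ends in the cell of height 0,
  where the second one starts. Conversely, since the profile of the origin is \<open>(1, 0, \<dots>, 0)\<close>, the only cell
  of the origin has height 0, so the second algorithm ends where the first one starts.\<close>

section \<open>Cells\<close>

lemma pt_in_triangle: "a + b + c = L \<Longrightarrow> pt a b c \<in> triangle L"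
  unfolding triangle_def by blast

lemma origin_eq_pt: "origin L = pt 0 0 L"
  by (simp add: origin_def pt_def)

lemma origin_in_triangle: "origin L \<in> triangle L"
  by (simp add: origin_eq_pt pt_in_triangle)

lemma profile_0: "profile a b c 0 = 1"
  by (simp add: profile_def fps_divide_unit power2_eq_square)

text \<open>With \<open>a = b = 0\<close> the two linear factors cancel the denominator and leave
  \<open>1 - fps_X ^ (c + 1)\<close>, whose coefficients strictly between 0 and \<open>c + 1\<close>
  vanish.\<close>

lemma profile_corner:
  assumes "0 < f" "f \<le> c"
  shows "profile 0 0 c f = 0"
proof -
  \<comment> \<open>Cancelling needs a nonzero denominator; its constant coefficient is 1.\<close>
  have "(1 - fps_X :: real fps) ^ 2 \<noteq> 0"
    by (metis fps_nth_power_0 fps_zero_nth fps_one_nth fps_sub_nth fps_X_nth diff_zero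
        power_one zero_neq_one)
  then have "(1 - fps_X ^ (0 + 1)) * (1 - fps_X ^ (0 + 1)) * (1 - fps_X ^ (c + 1)) / (1 - fps_X)\<^sup>2
      = (1 - fps_X ^ (c + 1) :: real fps)"
    by (simp add: power2_eq_square)
  then show ?thesis
    using assms by (simp add: profile_def fps_X_power_nth del: power_Suc)
qed

context
  fixes L :: nat and C :: "point \<Rightarrow> cell set"
  assumes rep: "cell_representation L C"
begin

lemma cell_in_triangle: "c \<in> C z \<Longrightarrow> z \<in> triangle L"
  using rep unfolding cell_representation_def by blast

lemma cell_height_le: "c \<in> C z \<Longrightarrow> cell_height c \<le> L div 2"
  using rep cell_in_triangle unfolding cell_representation_def by fastforce

lemma card_cells_pt:
  "a + b + c = L \<Longrightarrow> f \<le> L div 2 \<Longrightarrow> real (card {l. (f, l) \<in> C (pt a b c)}) = profile a b c f"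
  using rep unfolding cell_representation_def by blast

text \<open>The constant coefficient of every profile is 1. This justifies the definite description
  in \<open>ground_cell\<close>.\<close>

lemma ground_cell_unique:
  assumes "z \<in> triangle L"
  shows "\<exists>!c. c \<in> C z \<and> cell_height c = 0"
proof -
  obtain a b c where z: "z = pt a b c" "a + b + c = L"
    using assms unfolding triangle_def by blast
  have "card {l. (0, l) \<in> C z} = 1"
    using card_cells_pt[OF z(2), of 0] z(1) profile_0 by simp
  then obtain l where l: "{l. (0, l) \<in> C z} = {l}"
    by (auto simp: card_1_singleton_iff)
  show ?thesis
  proof (rule ex1I[of _ "(0, l)"])
    show "(0, l) \<in> C z \<and> cell_height (0, l) = 0" using l by auto
    show "c = (0, l)" if "c \<in> C z \<and> cell_height c = 0" for c
      using that l by (cases c) auto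
  qed
qed

lemma ground_cell_in: "z \<in> triangle L \<Longrightarrow> ground_cell C z \<in> C z"
  and ground_cell_height: "z \<in> triangle L \<Longrightarrow> cell_height (ground_cell C z) = 0"
  using theI'[OF ground_cell_unique] unfolding ground_cell_def by blast+

lemma ground_cell_eqI: "c \<in> C z \<Longrightarrow> cell_height c = 0 \<Longrightarrow> ground_cell C z = c"
  using ground_cell_unique[OF cell_in_triangle] ground_cell_in ground_cell_height
    cell_in_triangle by blast

text \<open>A cell of height \<open>f\<close> makes the coefficient of index \<open>f\<close>
  nonzero, and \<open>f \<le> L div 2\<close> is too small to reach the exponent
  \<open>L + 1\<close>, so \<open>f = 0\<close>.\<close>

lemma origin_cell:
  assumes "c \<in> C (origin L)"
  shows "c = ground_cell C (origin L)"
proof -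
  obtain f l where c: "c = (f, l)" by (cases c)
  have le: "f \<le> L div 2" using cell_height_le[OF assms] c by simp
  \<comment> \<open>Finiteness is essential here: \<open>card\<close> of an infinite set is 0 by
    default.\<close>
  have "finite (C (origin L))"
    using rep origin_in_triangle unfolding cell_representation_def by blast
  then have "finite {l. (f, l) \<in> C (origin L)}"
    by (rule finite_subset[rotated, OF finite_imageI[of _ snd]]) force
  then have "card {l. (f, l) \<in> C (origin L)} \<noteq> 0"
    using assms c by auto
  then have "profile 0 0 L f \<noteq> 0"
    using card_cells_pt[of 0 0 L f] le by (simp add: origin_eq_pt)
  then have "f = 0"
    using profile_corner[of f L] le by (cases "f = 0") auto
  then show ?thesis
    using ground_cell_eqI[OF assms] c by simp
qed

end


section \<open>Bounded Motzkin paths\<close>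

lemma height_after_0 [simp]: "height_after m 0 = 0"
  by (simp add: height_after_def)

lemma height_after_Cons_Suc [simp]: "height_after (s # m) (Suc k) = rise s + height_after m k"
  by (simp add: height_after_def)

lemma height_after_Suc:
  "k < length m \<Longrightarrow> height_after m (Suc k) = height_after m k + rise (m ! k)"
  by (simp add: height_after_def take_Suc_conv_app_nth)

lemma height_after_length: "height_after m (length m) = sum_list (map rise m)"
  by (simp add: height_after_def)

lemma height_after_le_max_height: "k \<le> length m \<Longrightarrow> height_after m k \<le> max_height m"
  by (simp add: max_height_def)

lemma max_height_attained: "\<exists>k \<le> length m. max_height m = height_after m k"
proof -
  have "max_height m \<in> height_after m ` {0..length m}"
    unfolding max_height_def by (rule Max_in) auto
  then show ?thesis by auto
qed

text \<open>Mirrors the guard of the first loop, from an arbitrary starting height so that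
  inductions go through. The conversion \<open>nat\<close> loses nothing, since an allowed step
  never leads below 0.\<close>

primrec steps_allowed :: "nat \<Rightarrow> nat \<Rightarrow> mstep list \<Rightarrow> bool" where
  "steps_allowed L f [] \<longleftrightarrow> True"
| "steps_allowed L f (s # m) \<longleftrightarrow>
     step_allowed L f s \<and> steps_allowed L (nat (int f + rise s)) m"

lemma step_allowed_nonneg: "step_allowed L f s \<Longrightarrow> 0 \<le> int f + rise s"
  by (cases s) (auto simp: step_allowed_def)

lemma step_allowed_le:
  "step_allowed L f s \<Longrightarrow> f \<le> L div 2 \<Longrightarrow> int f + rise s \<le> int (L div 2)"
  by (cases s) (auto simp: step_allowed_def)

text \<open>Links the recursive form, suited to runs, with the positional form in which heights and
  amplitude are expressed.\<close>

lemma steps_allowed_iff: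
  "steps_allowed L f m \<longleftrightarrow>
     (\<forall>k < length m. step_allowed L (nat (int f + height_after m k)) (m ! k))"
proof (induction m arbitrary: f)
  case (Cons s m)
  have "int (nat (int f + rise s)) + height_after m k = int f + (rise s + height_after m k)"
    if "step_allowed L f s" for k
    using step_allowed_nonneg[OF that] by simp
  then show ?case
    by (auto simp: All_less_Suc2 Cons.IH algebra_simps)
qed simp

lemma steps_allowed_height_bounds:
  assumes "steps_allowed L 0 m" "k \<le> length m"
  shows "0 \<le> height_after m k \<and> height_after m k \<le> int (L div 2)"
  using assms(2)
proof (induction k)
  case (Suc k)
  then have k: "k < length m" and IH: "0 \<le> height_after m k" "height_after m k \<le> int (L div 2)"
    by auto
  have "step_allowed L (nat (height_after m k)) (m ! k)"
    using assms(1) k by (simp add: steps_allowed_iff)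
  from step_allowed_nonneg[OF this] step_allowed_le[OF this] show ?case
    using IH by (auto simp: height_after_Suc[OF k])
qed simp

text \<open>Amplitude at most \<open>L\<close> keeps the heights at or below \<open>L div 2\<close>,
  which forbids \<open>Up\<close> there; nonnegativity forbids \<open>Down\<close> from 0. The extra
  1 for a flat step at maximal height exceeds the bound exactly when \<open>L\<close> is even and
  this height is \<open>L div 2\<close>.\<close>

lemma amplitude_le_iff:
  assumes "motzkin_path m"
  shows "amplitude m \<le> int L \<longleftrightarrow> steps_allowed L 0 m"
proof
  assume amp: "amplitude m \<le> int L"
  then have max: "2 * max_height m \<le> int L"
    by (auto simp: amplitude_def split: if_splits)
  show "steps_allowed L 0 m"
    unfolding steps_allowed_iff
  proof (intro allI impI)
    fix k assume k: "k < length m"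
    let ?h = "height_after m k"
    have h: "0 \<le> ?h" "0 \<le> ?h + rise (m ! k)" "?h \<le> max_height m"
      "?h + rise (m ! k) \<le> max_height m"
      using assms k height_after_le_max_height[of k m] height_after_le_max_height[of "Suc k" m]
      by (auto simp: motzkin_path_def simp flip: height_after_Suc)
    have flat: "2 * max_height m + 1 \<le> int L" if "m ! k = Flat" "?h = max_height m"
      using amp that k by (auto simp: amplitude_def split: if_splits)
    have "\<not> (nat ?h = 0 \<and> m ! k = Down)" using h by auto
    moreover have "\<not> (nat ?h = L div 2 \<and> m ! k = Up)" using h max by auto
    moreover have "\<not> (even L \<and> nat ?h = L div 2 \<and> m ! k = Flat)"
    proof (rule notI, elim conjE)
      assume *: "even L" "nat ?h = L div 2" "m ! k = Flat"
      \<comment> \<open>Since 2 \<open>max_height m\<close> is at most \<open>L\<close>, this height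
        is the maximum, and \<open>flat\<close> would give \<open>L + 1 \<le> L\<close>.\<close>
      then have "2 * ?h = int L" using h(1) by auto
      then show False using flat * h max by auto
    qed
    ultimately show "step_allowed L (nat (int 0 + ?h)) (m ! k)"
      by (simp add: step_allowed_def)
  qed
next
  assume ok: "steps_allowed L 0 m"
  obtain j where j: "j \<le> length m" "max_height m = height_after m j"
    using max_height_attained by blast
  have max: "0 \<le> max_height m" "max_height m \<le> int (L div 2)"
    using steps_allowed_height_bounds[OF ok j(1)] j(2) by auto
  show "amplitude m \<le> int L"
  proof (cases "\<exists>i < length m. m ! i = Flat \<and> height_after m i = max_height m")
    case True
    then obtain i where i: "i < length m" "m ! i = Flat" "height_after m i = max_height m"
      by blast
    have "step_allowed L (nat (max_height m)) Flat"
      using ok i unfolding steps_allowed_iff by force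
    then have "odd L \<or> nat (max_height m) \<noteq> L div 2"
      by (auto simp: step_allowed_def)
    \<comment> \<open>Strictly below \<open>L div 2\<close> the bound holds for either parity; at
      \<open>L div 2\<close> the allowed flat step forces \<open>L\<close> to be odd, and then 2
      (\<open>L div 2\<close>) + 1 = \<open>L\<close>.\<close>
    moreover have "2 * max_height m + 1 \<le> int L" if "max_height m < int (L div 2)"
      using that by linarith
    moreover have "2 * max_height m + 1 \<le> int L" if "odd L"
      using that max by (auto elim!: oddE)
    ultimately have "2 * max_height m + 1 \<le> int L"
      using max by (cases "max_height m = int (L div 2)") auto
    then show ?thesis using True by (simp add: amplitude_def)
  next
    case False
    have "2 * max_height m \<le> int L" using max by linarith
    then show ?thesis using False by (auto simp: amplitude_def)
  qed
qed

text \<open>Allowed steps already enforce nonnegative heights, so only the return to height 0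
  remains to be required.\<close>

lemma bounded_motzkin_paths_iff:
  "m \<in> bounded_motzkin_paths L n \<longleftrightarrow>
     length m = n \<and> steps_allowed L 0 m \<and> sum_list (map rise m) = 0"
proof -
  have "motzkin_path m \<longleftrightarrow> sum_list (map rise m) = 0" if "steps_allowed L 0 m"
    using steps_allowed_height_bounds[OF that] by (auto simp: motzkin_path_def height_after_length)
  then show ?thesis
    using amplitude_le_iff[of m L]
    by (auto simp: bounded_motzkin_paths_def motzkin_path_def height_after_length)
qed


section \<open>Forward paths\<close>

lemma forward_path_Nil [simp]: "forward_path L z [] \<longleftrightarrow> z \<in> triangle L"
  by (simp add: forward_path_def)

lemma forward_path_Cons [simp]:
  "forward_path L z (\<sigma> # p) \<longleftrightarrow>
     z \<in> triangle L \<and> \<sigma> \<in> {s\<^sub>1, s\<^sub>2, s\<^sub>3} \<and> forward_path L (z + \<sigma>) p"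
proof -
  have "(\<forall>k \<le> Suc n. P k) \<longleftrightarrow> P 0 \<and> (\<forall>k \<le> n. P (Suc k))" for n and P :: "nat \<Rightarrow> bool"
    using All_less_Suc2[of "Suc n" P] by (simp add: less_Suc_eq_le)
  then show ?thesis
    unfolding forward_path_def by (auto simp: add.assoc)
qed

lemma forward_path_end: "forward_path L z p \<Longrightarrow> z + sum_list p \<in> triangle L"
  unfolding forward_path_def by (metis order_refl take_all)

lemma in_successors_iff: "(\<sigma>, c) \<in> successors C z \<longleftrightarrow> \<sigma> \<in> {s\<^sub>1, s\<^sub>2, s\<^sub>3} \<and> c \<in> C (z + \<sigma>)"
  by (auto simp: successors_def)


section \<open>Runs\<close>

text \<open>A direction-free trace of both loops: it carries both words and the point and cell at
  each end, and the end cells are arbitrary so that a run can be cut anywhere.\<close>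

inductive run ::
  "nat \<Rightarrow> (point \<Rightarrow> cell set) \<Rightarrow> (point \<Rightarrow> cell \<times> mstep \<Rightarrow> point \<times> cell) \<Rightarrow>
   point \<Rightarrow> cell \<Rightarrow> mstep list \<Rightarrow> point list \<Rightarrow> point \<Rightarrow> cell \<Rightarrow> bool"
  for L C \<delta> where
  Nil: "run L C \<delta> z c [] [] z c"
| Cons: "run L C \<delta> z c (s # m) (\<sigma> # p) z' c'"
  if "z \<in> triangle L" "(c, s) \<in> allowed L C z" "\<delta> z (c, s) = (\<sigma>, c\<^sub>1)"
    "run L C \<delta> (z + \<sigma>) c\<^sub>1 m p z' c'"

lemma motzkin_to_forward_loop_run:
  "run L C \<delta> z c m p z' c' \<Longrightarrow> motzkin_to_forward_loop L C \<delta> (q, z, c) m = Some (q @ p)"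
  by (induction arbitrary: q rule: run.induct) simp_all

context
  fixes L :: nat and C :: "point \<Rightarrow> cell set" and \<delta> :: "point \<Rightarrow> cell \<times> mstep \<Rightarrow> point \<times> cell"
  assumes rep: "cell_representation L C" and scaf: "scaffolding L C \<delta>"
begin

lemma scaffolding_bij: "z \<in> triangle L \<Longrightarrow> bij_betw (\<delta> z) (allowed L C z) (successors C z)"
  using scaf unfolding scaffolding_def by blast

lemma scaffolding_step:
  assumes "(c, s) \<in> allowed L C z" "\<delta> z (c, s) = (\<sigma>, c')"
  shows "z \<in> triangle L" "\<sigma> \<in> {s\<^sub>1, s\<^sub>2, s\<^sub>3}" "c' \<in> C (z + \<sigma>)"
    "int (cell_height c') = int (cell_height c) + rise s"
proof -
  show z: "z \<in> triangle L"
    using assms(1) cell_in_triangle[OF rep, of c z] by (simp add: allowed_def)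
  have "(\<sigma>, c') \<in> successors C z"
    using bij_betwE[OF scaffolding_bij[OF z]] assms by metis
  then show "\<sigma> \<in> {s\<^sub>1, s\<^sub>2, s\<^sub>3}" "c' \<in> C (z + \<sigma>)"
    by (auto simp: in_successors_iff)
  show "int (cell_height c') = int (cell_height c) + rise s"
    using scaf z assms unfolding scaffolding_def by blast
qed

text \<open>The second loop consumes the first step of the run last. Generalising over
  \<open>rest\<close> lets the induction hypothesis process the tail with this step put in front of
  \<open>rest\<close>; injectivity of \<open>\<delta> z\<close> then recovers the cell and the
  Motzkin step.\<close>

lemma forward_to_motzkin_loop_run:
  "run L C \<delta> z c m p z' c' \<Longrightarrow>
     forward_to_motzkin_loop L C \<delta> (q, z', c') (rev p @ rest) =
     forward_to_motzkin_loop L C \<delta> (m @ q, z, c) rest"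
proof (induction arbitrary: rest rule: run.induct)
  case (Cons z c s \<sigma> c\<^sub>1 m p z' c')
  have "the_inv_into (allowed L C z) (\<delta> z) (\<sigma>, c\<^sub>1) = (c, s)"
    using the_inv_into_f_f[OF bij_betw_imp_inj_on[OF scaffolding_bij] Cons.hyps(2)] Cons.hyps
    by simp
  then show ?case
    using Cons scaffolding_step[OF Cons.hyps(2,3)] by (simp add: in_successors_iff)
qed simp

lemma run_properties:
  assumes "run L C \<delta> z c m p z' c'" "c \<in> C z"
  shows "length p = length m \<and> forward_path L z p \<and> z' = z + sum_list p \<and> c' \<in> C z' \<and>
    steps_allowed L (cell_height c) m \<and>
    int (cell_height c') = int (cell_height c) + sum_list (map rise m)"
  using assms
proof (induction rule: run.induct)
  case (Nil z c)
  then show ?case using cell_in_triangle[OF rep] by simp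
next
  case (Cons z c s \<sigma> c\<^sub>1 m p z' c')
  note step = scaffolding_step[OF Cons.hyps(2,3)]
  have "nat (int (cell_height c) + rise s) = cell_height c\<^sub>1"
    by (simp flip: step(4))
  then show ?case
    using Cons.IH[OF step(3)] Cons.hyps(2) step by (auto simp: allowed_def add.assoc)
qed

text \<open>An allowed step puts the pair in the domain of \<open>\<delta> z\<close>, and the image
  is a cell at the next point whose height is the one \<open>steps_allowed\<close> continues
  with.\<close>

lemma run_exists_forward:
  "c \<in> C z \<Longrightarrow> steps_allowed L (cell_height c) m \<Longrightarrow> \<exists>p z' c'. run L C \<delta> z c m p z' c'"
proof (induction m arbitrary: z c)
  case (Cons s m)
  obtain \<sigma> c\<^sub>1 where \<delta>: "\<delta> z (c, s) = (\<sigma>, c\<^sub>1)" by (meson surj_pair)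
  have al: "(c, s) \<in> allowed L C z" using Cons.prems by (simp add: allowed_def)
  note step = scaffolding_step[OF al \<delta>]
  have "nat (int (cell_height c) + rise s) = cell_height c\<^sub>1"
    by (simp flip: step(4))
  then have "steps_allowed L (cell_height c\<^sub>1) m" using Cons.prems by simp
  from Cons.IH[OF step(3) this] show ?case
    using run.Cons[where L = L and C = C and \<delta> = \<delta>, OF step(1) al \<delta>] by blast
qed (blast intro: run.Nil)

text \<open>The end cell is prescribed and the start cell is found: once the tail has a run,
  surjectivity of \<open>\<delta> z\<close> onto the successors supplies the first step.\<close>

lemma run_exists_backward:
  "forward_path L z p \<Longrightarrow> c' \<in> C (z + sum_list p) \<Longrightarrow>
     \<exists>c m. c \<in> C z \<and> run L C \<delta> z c m p (z + sum_list p) c'"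
proof (induction p arbitrary: z)
  case Nil
  then have "run L C \<delta> z c' [] [] (z + sum_list []) c'" by (simp add: run.Nil)
  then show ?case using Nil.prems(2) by (auto simp del: split_paired_Ex)
next
  case (Cons \<sigma> p)
  have "forward_path L (z + \<sigma>) p" "c' \<in> C (z + \<sigma> + sum_list p)"
    using Cons.prems by (auto simp: add.assoc)
  from Cons.IH[OF this] obtain c\<^sub>1 m where c\<^sub>1: "c\<^sub>1 \<in> C (z + \<sigma>)"
    and run: "run L C \<delta> (z + \<sigma>) c\<^sub>1 m p (z + sum_list (\<sigma> # p)) c'"
    unfolding sum_list.Cons add.assoc by blast
  have z: "z \<in> triangle L" using Cons.prems by simp
  have "(\<sigma>, c\<^sub>1) \<in> successors C z" using Cons.prems c\<^sub>1 by (simp add: in_successors_iff)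
  then obtain c s where al: "(c, s) \<in> allowed L C z" and \<delta>: "\<delta> z (c, s) = (\<sigma>, c\<^sub>1)"
    using bij_betw_imp_surj_on[OF scaffolding_bij[OF z]] by (metis imageE surj_pair)
  have "c \<in> C z" using al by (simp add: allowed_def)
  then show ?case using run.Cons[where L = L and C = C and \<delta> = \<delta>, OF z al \<delta> run] by blast
qed

text \<open>The graph of the sought bijection, expressed without favouring either algorithm: a run
  joining the ground cells at both ends.\<close>

definition corresponds :: "mstep list \<Rightarrow> point list \<Rightarrow> bool" where
  "corresponds m p \<longleftrightarrow>
     (let z = origin L + sum_list p
      in run L C \<delta> (origin L) (ground_cell C (origin L)) m p z (ground_cell C z))"

lemma corresponds_algorithms:
  assumes "corresponds m p"
  shows "motzkin_to_forward L C \<delta> m = Some p" "forward_to_motzkin L C \<delta> p = Some m"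
proof -
  note run = assms[unfolded corresponds_def Let_def]
  show "motzkin_to_forward L C \<delta> m = Some p"
    using motzkin_to_forward_loop_run[OF run] by (simp add: motzkin_to_forward_def)
  show "forward_to_motzkin L C \<delta> p = Some m"
    using forward_to_motzkin_loop_run[OF run, of "[]" "[]"]
    by (simp add: forward_to_motzkin_def Let_def)
qed

lemma ex_corresponding_forward_path:
  assumes "m \<in> bounded_motzkin_paths L n"
  shows "\<exists>p \<in> forward_paths L n. corresponds m p"
proof -
  let ?c = "ground_cell C (origin L)"
  have c: "?c \<in> C (origin L)" "cell_height ?c = 0"
    using ground_cell_in[OF rep] ground_cell_height[OF rep] origin_in_triangle by blast+
  have m: "length m = n" "steps_allowed L (cell_height ?c) m" "sum_list (map rise m) = 0"
    using assms c by (auto simp: bounded_motzkin_paths_iff)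
  obtain p z' c' where run: "run L C \<delta> (origin L) ?c m p z' c'"
    using run_exists_forward[OF c(1) m(2)] by blast
  note props = run_properties[OF run c(1)]
  \<comment> \<open>The rises sum to 0 and the run starts at height 0, so its last cell has height 0
    and is the ground cell by uniqueness.\<close>
  have "ground_cell C z' = c'"
    using props m c by (intro ground_cell_eqI[OF rep]) auto
  then show ?thesis
    using run props m by (auto simp: corresponds_def forward_paths_def)
qed

lemma ex_corresponding_motzkin_path:
  assumes "p \<in> forward_paths L n"
  shows "\<exists>m \<in> bounded_motzkin_paths L n. corresponds m p"
proof -
  have p: "length p = n" "forward_path L (origin L) p"
    using assms by (auto simp: forward_paths_def)
  let ?z = "origin L + sum_list p"
  have z: "?z \<in> triangle L" using forward_path_end[OF p(2)] .
  obtain c m where c: "c \<in> C (origin L)"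
    and run: "run L C \<delta> (origin L) c m p ?z (ground_cell C ?z)"
    using run_exists_backward[OF p(2) ground_cell_in[OF rep z]] by blast
  \<comment> \<open>Going backwards, surjectivity gives no control over the start cell; it is pinned
    down because the origin has only one cell.\<close>
  have c_eq: "c = ground_cell C (origin L)" by (rule origin_cell[OF rep c])
  then have "cell_height c = 0" using ground_cell_height[OF rep origin_in_triangle] by simp
  then have "m \<in> bounded_motzkin_paths L n"
    using run_properties[OF run c] ground_cell_height[OF rep z] p
    by (simp add: bounded_motzkin_paths_iff)
  then show ?thesis
    using run c_eq by (auto simp: corresponds_def Let_def)
qed

end

theorem theorem27:
  fixes L n :: nat
    and C :: "point \<Rightarrow> cell set"
    and \<delta> :: "point \<Rightarrow> cell \<times> mstep \<Rightarrow> point \<times> cell"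
  assumes "cell_representation L C"
    and "scaffolding L C \<delta>"
  shows "(\<forall>m \<in> bounded_motzkin_paths L n. motzkin_to_forward L C \<delta> m \<noteq> None) \<and>
         (\<forall>p \<in> forward_paths L n. forward_to_motzkin L C \<delta> p \<noteq> None) \<and>
         bij_betw (\<lambda>m. the (motzkin_to_forward L C \<delta> m))
           (bounded_motzkin_paths L n) (forward_paths L n) \<and>
         bij_betw (\<lambda>p. the (forward_to_motzkin L C \<delta> p))
           (forward_paths L n) (bounded_motzkin_paths L n) \<and>
         (\<forall>m \<in> bounded_motzkin_paths L n.
            forward_to_motzkin L C \<delta> (the (motzkin_to_forward L C \<delta> m)) = Some m) \<and>
         (\<forall>p \<in> forward_paths L n.
            motzkin_to_forward L C \<delta> (the (forward_to_motzkin L C \<delta> p)) = Some p)"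
proof -
  let ?M = "bounded_motzkin_paths L n" and ?F = "forward_paths L n"
  \<comment> \<open>Both directions yield the same pair of equations, so each algorithm serves as
    the inverse witness for the other.\<close>
  have fwd: "\<exists>p \<in> ?F. motzkin_to_forward L C \<delta> m = Some p \<and> forward_to_motzkin L C \<delta> p = Some m"
    if "m \<in> ?M" for m
    using ex_corresponding_forward_path[OF assms that] corresponds_algorithms[OF assms] by blast
  have bwd: "\<exists>m \<in> ?M. motzkin_to_forward L C \<delta> m = Some p \<and> forward_to_motzkin L C \<delta> p = Some m"
    if "p \<in> ?F" for p
    using ex_corresponding_motzkin_path[OF assms that] corresponds_algorithms[OF assms] by blast
  have "bij_betw (\<lambda>m. the (motzkin_to_forward L C \<delta> m)) ?M ?F"
    by (rule bij_betw_byWitness[where f' = "\<lambda>p. the (forward_to_motzkin L C \<delta> p)"])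
      (use fwd bwd in force)+
  moreover have "bij_betw (\<lambda>p. the (forward_to_motzkin L C \<delta> p)) ?F ?M"
    by (rule bij_betw_byWitness[where f' = "\<lambda>m. the (motzkin_to_forward L C \<delta> m)"])
      (use fwd bwd in force)+
  ultimately show ?thesis
    using fwd bwd by (intro conjI ballI) force+
qed

end
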